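(* Let $q\in L_{1,loc}(\mathbb{R}_+)$ be a complex-valued function, $\mathbb{R}_+=[0,+\infty)$, and let $l(y)=-y''+qy$. Put $$\mathscr{D}=\{y\in L_2(\mathbb{R}_+):\ y,y'\in AC_{loc}(\mathbb{R}_+),\ l(y)\in L_2(\mathbb{R}_+)\},$$ $$\mathscr{D}_0=\{y\in\mathscr{D}:\ y(0)=y'(0)=0,\ \exists x_0>0\ \forall x\ge x_0\ y(x)=0\},$$ and let $L_0$ be the operator in $L_2(\mathbb{R}_+)$ with domain $\mathscr{D}_0$ acting by $L_0y=l(y)$. If $L_0$ has an extension (an operator $L\supset L_0$ in $L_2(\mathbb{R}_+)$) with compact resolvent, then $q$ satisfies the Molchanov condition: for every infinite system of pairwise disjoint intervals $D_n\subset\mathbb{R}_+$ of equal length, $$\int_{D_n}|q(x)|\,dx\to+\infty\quad\text{as } n\to\infty.$$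
   Context: $AC_{loc}(\mathbb{R}_+)$ denotes functions absolutely continuous on every compact subinterval of $[0,+\infty)$. An operator has compact resolvent if its resolvent set is nonempty and its resolvent is a compact operator. *)

theory Defs
  imports "HOL-Analysis.Analysis"
begin

text \<open>Elements of L_2(R_+) are represented by functions real => complex, considered on
  [0,+oo) and modulo equality almost everywhere.\<close>

definition L2p :: "(real \<Rightarrow> complex) set" where
  "L2p = {f. set_borel_measurable lborel {0..} f \<and>
             set_integrable lborel {0..} (\<lambda>x. (cmod (f x))\<^sup>2)}"

definition l2norm :: "(real \<Rightarrow> complex) \<Rightarrow> real" where
  "l2norm f = sqrt (LINT x:{0..}|lborel. (cmod (f x))\<^sup>2)"

definition ae_eq :: "(real \<Rightarrow> complex) \<Rightarrow> (real \<Rightarrow> complex) \<Rightarrow> bool" (infix "\<doteq>" 50) where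
  "f \<doteq> g \<longleftrightarrow> (AE x in lborel. x \<ge> 0 \<longrightarrow> f x = g x)"

definition L1loc :: "(real \<Rightarrow> complex) \<Rightarrow> bool" where
  "L1loc q \<longleftrightarrow> (\<forall>b\<ge>0. set_integrable lborel {0..b} q)"

definition ac_on :: "real \<Rightarrow> real \<Rightarrow> (real \<Rightarrow> complex) \<Rightarrow> bool" where
  "ac_on a b f \<longleftrightarrow> (\<forall>\<epsilon>>0. \<exists>\<delta>>0. \<forall>(n::nat) (u::nat \<Rightarrow> real) (v::nat \<Rightarrow> real).
      (\<forall>i<n. a \<le> u i \<and> u i \<le> v i \<and> v i \<le> b) \<and>
      (\<forall>i<n. \<forall>j<n. i \<noteq> j \<longrightarrow> v i \<le> u j \<or> v j \<le> u i) \<and>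
      (\<Sum>i<n. v i - u i) < \<delta> \<longrightarrow> (\<Sum>i<n. cmod (f (v i) - f (u i))) < \<epsilon>)"

definition AC_loc :: "(real \<Rightarrow> complex) \<Rightarrow> bool" where
  "AC_loc f \<longleftrightarrow> (\<forall>b\<ge>0. ac_on 0 b f)"

definition ae_deriv :: "(real \<Rightarrow> complex) \<Rightarrow> (real \<Rightarrow> complex) \<Rightarrow> bool" where
  "ae_deriv f f' \<longleftrightarrow> (AE x in lborel. x > 0 \<longrightarrow> (f has_vector_derivative f' x) (at x))"

text \<open>The maximal set D together with the action of l: pairs (y, l(y)).
  y1 is the (AC_loc representative of the) derivative y', y2 = y''.\<close>
definition maxgraph :: "(real \<Rightarrow> complex) \<Rightarrow> ((real \<Rightarrow> complex) \<times> (real \<Rightarrow> complex)) set" where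
  "maxgraph q = {(y, g). y \<in> L2p \<and> g \<in> L2p \<and>
     (\<exists>y1 y2. AC_loc y \<and> AC_loc y1 \<and> ae_deriv y y1 \<and> ae_deriv y1 y2 \<and>
        g = (\<lambda>x. - y2 x + q x * y x))}"

definition L0graph :: "(real \<Rightarrow> complex) \<Rightarrow> ((real \<Rightarrow> complex) \<times> (real \<Rightarrow> complex)) set" where
  "L0graph q = {(y, g). y \<in> L2p \<and> g \<in> L2p \<and>
     (\<exists>y1 y2. AC_loc y \<and> AC_loc y1 \<and> ae_deriv y y1 \<and> ae_deriv y1 y2 \<and>
        g = (\<lambda>x. - y2 x + q x * y x) \<and>
        y 0 = 0 \<and> y1 0 = 0 \<and> (\<exists>x0>0. \<forall>x\<ge>x0. y x = 0))}"

definition is_operator :: "((real \<Rightarrow> complex) \<times> (real \<Rightarrow> complex)) set \<Rightarrow> bool" where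
  "is_operator G \<longleftrightarrow> G \<subseteq> L2p \<times> L2p \<and> (\<lambda>_. 0, \<lambda>_. 0) \<in> G \<and>
     (\<forall>(y,g)\<in>G. \<forall>(z,h)\<in>G. (\<lambda>x. y x + z x, \<lambda>x. g x + h x) \<in> G) \<and>
     (\<forall>(y,g)\<in>G. \<forall>c::complex. (\<lambda>x. c * y x, \<lambda>x. c * g x) \<in> G) \<and>
     (\<forall>(y,g)\<in>G. \<forall>(z,h)\<in>G. y \<doteq> z \<longrightarrow> g \<doteq> h)"

definition extends :: "((real \<Rightarrow> complex) \<times> (real \<Rightarrow> complex)) set \<Rightarrow>
    ((real \<Rightarrow> complex) \<times> (real \<Rightarrow> complex)) set \<Rightarrow> bool" where
  "extends G G0 \<longleftrightarrow> (\<forall>(y,g)\<in>G0. \<exists>(z,h)\<in>G. z \<doteq> y \<and> h \<doteq> g)"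

text \<open>Compact resolvent: some lambda lies in the resolvent set, i.e. L - lambda is a
  bijection of the domain onto L_2 with everywhere-defined inverse, and this inverse
  (the resolvent) is compact: it maps bounded sequences to sequences having an
  L_2-Cauchy (hence convergent) subsequence. (Compactness implies boundedness.)\<close>
definition has_compact_resolvent :: "((real \<Rightarrow> complex) \<times> (real \<Rightarrow> complex)) set \<Rightarrow> bool" where
  "has_compact_resolvent G \<longleftrightarrow> (\<exists>\<mu>::complex.
     (\<forall>f\<in>L2p. \<exists>(y,g)\<in>G. (\<lambda>x. g x - \<mu> * y x) \<doteq> f) \<and>
     (\<forall>(y,g)\<in>G. (\<lambda>x. g x - \<mu> * y x) \<doteq> (\<lambda>_. 0) \<longrightarrow> y \<doteq> (\<lambda>_. 0)) \<and>
     (\<forall>(s::nat \<Rightarrow> (real \<Rightarrow> complex) \<times> (real \<Rightarrow> complex)) (B::real).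
        (\<forall>n. s n \<in> G \<and> l2norm (\<lambda>x. snd (s n) x - \<mu> * fst (s n) x) \<le> B) \<longrightarrow>
        (\<exists>r::nat\<Rightarrow>nat. strict_mono r \<and> (\<forall>\<epsilon>>0. \<exists>N::nat. \<forall>m\<ge>N. \<forall>n\<ge>N.
            l2norm (\<lambda>x. fst (s (r m)) x - fst (s (r n)) x) < \<epsilon>))))"

end

theory Submission
  imports Defs
begin

text \<open>
  If the Molchanov condition fails, infinitely many of the disjoint intervals carry a uniformly
  bounded mass of \<open>|q|\<close>. After shortening them to a common small length, the Volterra equation
  for \<open>-u'' + q u = 0\<close>, \<open>u = 1\<close> and \<open>u' = 0\<close> at the left endpoint, is a contraction, and its
  solution satisfies \<open>|u - 1| \<le> 1/3\<close>. For a cutoff \<open>\<chi>\<close> supported in the interval the function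
  \<open>y = \<chi> u\<close> lies in the domain of \<open>L\<^sub>0\<close>, and \<open>l(y) = -\<chi>'' u - 2 \<chi>' u'\<close> no longer contains the
  unbounded factor \<open>q\<close>. This gives functions with disjoint supports, norms bounded below and
  \<open>(L - \<mu>) y\<close> bounded, contradicting compactness of the resolvent.
\<close>

section \<open>Indefinite Lebesgue integrals\<close>

text \<open>Integrating from minus infinity avoids signed integrals to the left of a base point. For
  the test functions the integrand vanishes to the left of \<open>a\<close>, so the integration in
  effect starts at \<open>a\<close>.\<close>

definition cumul :: "(real \<Rightarrow> complex) \<Rightarrow> real \<Rightarrow> complex" where
  "cumul f x = (LINT t:{..x}|lborel. f t)"

lemma cumul_increment:
  assumes "integrable lborel f" "u \<le> v"
  shows "cumul f v - cumul f u = (LINT t:{u<..v}|lborel. f t)"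
proof -
  have si: "set_integrable lborel A f" if "A \<in> sets borel" for A
    using integrable_mult_indicator[of A lborel f] that assms(1) by (simp add: set_integrable_def)
  have "{..v} = {..u} \<union> {u<..v}"
    using assms(2) by auto
  then have "cumul f v = cumul f u + (LINT t:{u<..v}|lborel. f t)"
    unfolding cumul_def by (simp only:) (rule set_integral_Un, auto intro: si)
  then show ?thesis by simp
qed

text \<open>Bridge to the gauge integral, in terms of which the differentiation theorem behind
  \<open>cumul_has_vector_derivative_AE\<close> is stated.\<close>

lemma cumul_increment_HK:
  assumes "integrable lborel f" "u \<le> v"
  shows "cumul f v - cumul f u = integral {u..v} f"
proof -
  have si: "set_integrable lborel {u<..v} f"
    using integrable_mult_indicator[of "{u<..v}" lborel f] assms(1) by (simp add: set_integrable_def)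
  have "integral {u..v} f = integral {u<..v} f"
    by (rule integral_spike_set) (auto intro: negligible_subset[of "{u,v}"])
  then show ?thesis
    using cumul_increment[OF assms] set_borel_integral_eq_integral(2)[OF si] by simp
qed

lemma norm_cumul_increment_le:
  assumes "integrable lborel f" "u \<le> v"
  shows "norm (cumul f v - cumul f u) \<le> (LINT t:{u<..v}|lborel. norm (f t))"
  using assms integrable_mult_indicator[of "{u<..v}" lborel f]
  by (auto simp: cumul_increment set_integrable_def intro!: set_integral_norm_bound)

lemma norm_cumul_le:
  assumes "integrable lborel f"
  shows "norm (cumul f x) \<le> (LINT t|lborel. norm (f t))"
proof -
  have si: "set_integrable lborel {..x} f"
    using integrable_mult_indicator[of "{..x}" lborel f] assms by (simp add: set_integrable_def)
  have "norm (cumul f x) \<le> (LINT t:{..x}|lborel. norm (f t))"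
    unfolding cumul_def by (rule set_integral_norm_bound[OF si])
  also have "\<dots> \<le> (LINT t|lborel. norm (f t))"
    unfolding set_lebesgue_integral_def
    using set_integrable_norm[OF si] assms
    by (intro integral_mono) (auto simp: set_integrable_def indicator_def)
  finally show ?thesis .
qed

lemma cumul_diff:
  assumes "integrable lborel f" "integrable lborel g"
  shows "cumul f x - cumul g x = cumul (\<lambda>t. f t - g t) x"
  unfolding cumul_def using assms integrable_mult_indicator[of "{..x}" lborel]
  by (subst set_integral_diff) (auto simp: set_integrable_def)

text \<open>Dominated convergence with majorant |f|: at each point the truncated function is 0 once
  k >= |f t|. This splits |f| into a bounded part and a part of small mass.\<close>

lemma integral_norm_tail_small:
  assumes "integrable lborel (f :: real \<Rightarrow> complex)" "\<epsilon> > 0"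
  obtains k :: nat where "(LINT t|lborel. (if norm (f t) > real k then norm (f t) else 0)) < \<epsilon>"
proof -
  have [measurable]: "f \<in> borel_measurable lborel" using assms(1) by simp
  have "(\<lambda>k. LINT t|lborel. (if norm (f t) > real k then norm (f t) else 0)) \<longlonglongrightarrow> (LINT t::real|lborel. (0::real))"
  proof (rule integral_dominated_convergence[where w="\<lambda>t. norm (f t)"])
    show "AE t in lborel. (\<lambda>k. if norm (f t) > real k then norm (f t) else 0) \<longlonglongrightarrow> 0"
    proof (rule AE_I2)
      fix t
      obtain K where "norm (f t) \<le> real K" using real_arch_simple by blast
      then have "\<forall>\<^sub>F k in sequentially. (if norm (f t) > real k then norm (f t) else 0) = 0"
        by (intro eventually_sequentiallyI[of K]) auto
      then show "(\<lambda>k. if norm (f t) > real k then norm (f t) else 0) \<longlonglongrightarrow> 0"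
        by (rule tendsto_eventually)
    qed
  qed (use assms in auto)
  then have "\<forall>\<^sub>F k in sequentially. (LINT t|lborel. (if norm (f t) > real k then norm (f t) else 0)) < \<epsilon>"
    using order_tendstoD(2)[of _ 0 sequentially \<epsilon>] assms(2) by simp
  then show ?thesis
    using that by (auto simp: eventually_sequentially)
qed

text \<open>Absolute continuity of the integral. With |f| <= (k + 1) + \<open>w\<close>, the
  constant contributes at most k + 1 times the total length, and \<open>w\<close> at most its whole
  mass, because the intervals do not overlap. Both \<open>AC_loc_cumul\<close> and
  \<open>continuous_cumul\<close> follow from it.\<close>

lemma cumul_increments_small:
  assumes f: "integrable lborel f" and "\<epsilon> > 0"
  obtains \<delta> where "\<delta> > 0"
    "\<And>(n::nat) u v. (\<And>i. i < n \<Longrightarrow> u i \<le> v i) \<Longrightarrow>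
      (\<And>i j. i < n \<Longrightarrow> j < n \<Longrightarrow> i \<noteq> j \<Longrightarrow> v i \<le> u j \<or> v j \<le> u i) \<Longrightarrow> (\<Sum>i<n. v i - u i) < \<delta> \<Longrightarrow>
      (\<Sum>i<n. cmod (cumul f (v i) - cumul f (u i))) < \<epsilon>"
proof -
  have [measurable]: "f \<in> borel_measurable lborel" using assms(1) by simp
  obtain k :: nat where k: "(LINT t|lborel. (if norm (f t) > real k then norm (f t) else 0)) < \<epsilon>/2"
    using integral_norm_tail_small[OF f, of "\<epsilon>/2"] assms by auto
  define w where "w t = (if norm (f t) > real k then norm (f t) else 0)" for t
  have wi: "integrable lborel w"
    unfolding w_def by (rule Bochner_Integration.integrable_bound[OF f]) auto
  show ?thesis
  \<comment> \<open>The bounded part is allotted one half of \<epsilon>; \<open>k + 1\<close> keeps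
    the denominator positive when k = 0.\<close>
  proof (rule that[of "\<epsilon>/(2*(real k+1))"])
    show "\<epsilon>/(2*(real k+1)) > 0" using assms by simp
    fix n :: nat and u v :: "nat \<Rightarrow> real"
    assume le: "\<And>i. i < n \<Longrightarrow> u i \<le> v i"
      and sep: "\<And>i j. i < n \<Longrightarrow> j < n \<Longrightarrow> i \<noteq> j \<Longrightarrow> v i \<le> u j \<or> v j \<le> u i"
      and short: "(\<Sum>i<n. v i - u i) < \<epsilon>/(2*(real k+1))"
    \<comment> \<open>Half-open intervals are truly disjoint even where the closed ones share an
      endpoint.\<close>
    have disj: "disjoint_family_on (\<lambda>i. {u i<..v i}) {..<n}"
      unfolding disjoint_family_on_def using sep by fastforce
    have "cmod (cumul f (v i) - cumul f (u i)) \<le>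
        (k + 1) * (v i - u i) + (LINT t:{u i<..v i}|lborel. w t)" if "i < n" for i
    proof -
      have ui: "u i \<le> v i" using le that by blast
      have wI: "set_integrable lborel {u i<..v i} w"
        using wi integrable_mult_indicator[of "{u i<..v i}" lborel w] by (simp add: set_integrable_def)
      have cI: "set_integrable lborel {u i<..v i} (\<lambda>t. k + 1 :: real)"
        unfolding set_integrable_def by (intro integrable_scaleR_left integrable_real_indicator) (use ui in auto)
      have "cmod (cumul f (v i) - cumul f (u i)) \<le> (LINT t:{u i<..v i}|lborel. norm (f t))"
        by (rule norm_cumul_increment_le[OF f ui])
      also have "\<dots> \<le> (LINT t:{u i<..v i}|lborel. (k + 1) + w t)"
      proof (rule set_integral_mono)
        show "set_integrable lborel {u i<..v i} (\<lambda>t. norm (f t))"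
          using f integrable_mult_indicator[of "{u i<..v i}" lborel "\<lambda>t. norm (f t)"] by (simp add: set_integrable_def)
        show "set_integrable lborel {u i<..v i} (\<lambda>t. (k + 1) + w t)"
          using set_integral_add(1)[OF cI wI] .
      qed (auto simp: w_def)
      also have "\<dots> = (LINT t:{u i<..v i}|lborel. real (k + 1)) + (LINT t:{u i<..v i}|lborel. w t)"
        using set_integral_add(2)[OF cI wI] by simp
      also have "(LINT t:{u i<..v i}|lborel. real (k + 1)) = (k + 1) * (v i - u i)"
        using ui by (simp add: set_lebesgue_integral_def)
      finally show ?thesis by simp
    qed
    then have "(\<Sum>i<n. cmod (cumul f (v i) - cumul f (u i))) \<le>
        (\<Sum>i<n. (k + 1) * (v i - u i) + (LINT t:{u i<..v i}|lborel. w t))"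
      by (intro sum_mono) auto
    also have "\<dots> = (k + 1) * (\<Sum>i<n. v i - u i) + (\<Sum>i<n. (LINT t:{u i<..v i}|lborel. w t))"
      by (simp add: sum.distrib sum_distrib_left)
    also have "(\<Sum>i<n. (LINT t:{u i<..v i}|lborel. w t)) \<le> (LINT t|lborel. w t)"
    proof -
      have "(\<Sum>i<n. (LINT t:{u i<..v i}|lborel. w t)) = (LINT t|lborel. (\<Sum>i<n. indicator {u i<..v i} t *\<^sub>R w t))"
        unfolding set_lebesgue_integral_def
        by (rule Bochner_Integration.integral_sum[symmetric])
           (intro integrable_mult_indicator wi, simp)
      also have "\<dots> = (LINT t|lborel. (indicator (\<Union>i<n. {u i<..v i}) t *\<^sub>R w t))"
        by (subst indicator_UN_disjoint[OF _ disj]) (auto simp: sum_distrib_right)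
      also have "\<dots> \<le> (LINT t|lborel. w t)"
        by (intro integral_mono integrable_mult_indicator wi) (auto simp: w_def indicator_def)
      finally show ?thesis .
    qed
    also have "(LINT t|lborel. w t) < \<epsilon>/2" using k unfolding w_def .
    also have "(k + 1) * (\<Sum>i<n. v i - u i) \<le> (k + 1) * (\<epsilon>/(2*(real k+1)))"
      using short by (intro mult_left_mono) auto
    also have "(k + 1) * (\<epsilon>/(2*(real k+1))) = \<epsilon>/2"
      by (simp add: divide_simps)
    finally show "(\<Sum>i<n. cmod (cumul f (v i) - cumul f (u i))) < \<epsilon>" by simp
  qed
qed

lemma AC_loc_cumul:
  assumes "integrable lborel f"
  shows "AC_loc (cumul f)"
  unfolding AC_loc_def ac_on_def
proof (intro allI impI)
  fix b \<epsilon> :: real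
  assume "\<epsilon> > 0"
  show "\<exists>\<delta>>0. \<forall>(n::nat) u v.
          (\<forall>i<n. 0 \<le> u i \<and> u i \<le> v i \<and> v i \<le> b) \<and>
          (\<forall>i<n. \<forall>j<n. i \<noteq> j \<longrightarrow> v i \<le> u j \<or> v j \<le> u i) \<and> (\<Sum>i<n. v i - u i) < \<delta> \<longrightarrow>
          (\<Sum>i<n. cmod (cumul f (v i) - cumul f (u i))) < \<epsilon>"
  proof (rule cumul_increments_small[OF assms \<open>\<epsilon> > 0\<close>])
    fix \<delta>
    assume d: "\<delta> > 0" "\<And>(n::nat) u v. (\<And>i. i < n \<Longrightarrow> u i \<le> v i) \<Longrightarrow>
      (\<And>i j. i < n \<Longrightarrow> j < n \<Longrightarrow> i \<noteq> j \<Longrightarrow> v i \<le> u j \<or> v j \<le> u i) \<Longrightarrow> (\<Sum>i<n. v i - u i) < \<delta> \<Longrightarrow>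
      (\<Sum>i<n. cmod (cumul f (v i) - cumul f (u i))) < \<epsilon>"
    show ?thesis
      by (intro exI[of _ \<delta>] conjI d(1) allI impI) (rule d(2); blast)
  qed
qed

lemma continuous_cumul:
  assumes "integrable lborel f"
  shows "continuous_on UNIV (cumul f)"
  unfolding continuous_on_iff
proof (intro ballI allI impI)
  fix x \<epsilon> :: real
  assume "\<epsilon> > 0"
  show "\<exists>d>0. \<forall>y\<in>UNIV. dist y x < d \<longrightarrow> dist (cumul f y) (cumul f x) < \<epsilon>"
  proof (rule cumul_increments_small[OF assms \<open>\<epsilon> > 0\<close>])
    fix \<delta>
    assume d: "\<delta> > 0" "\<And>(n::nat) u v. (\<And>i. i < n \<Longrightarrow> u i \<le> v i) \<Longrightarrow>
      (\<And>i j. i < n \<Longrightarrow> j < n \<Longrightarrow> i \<noteq> j \<Longrightarrow> v i \<le> u j \<or> v j \<le> u i) \<Longrightarrow> (\<Sum>i<n. v i - u i) < \<delta> \<Longrightarrow>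
      (\<Sum>i<n. cmod (cumul f (v i) - cumul f (u i))) < \<epsilon>"
    show ?thesis
    proof (intro exI[of _ \<delta>] conjI d(1) ballI impI)
      fix y assume y: "dist y x < \<delta>"
      \<comment> \<open>Continuity is the case of a single interval; \<open>min\<close> and
        \<open>max\<close> treat both orders of the two points at once.\<close>
      have "(\<Sum>i<Suc 0. cmod (cumul f (max x y) - cumul f (min x y))) < \<epsilon>"
        by (rule d(2)[of "Suc 0"]) (use y in \<open>auto simp: dist_real_def\<close>)
      then show "dist (cumul f y) (cumul f x) < \<epsilon>"
        by (cases "x \<le> y") (auto simp: dist_norm norm_minus_commute max_def min_def)
    qed
  qed
qed

text \<open>\<open>integrable_ccontinuous_explicit\<close> only provides right-hand derivatives; the left-hand ones
  come from applying it to the reflected function.\<close>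

lemma cumul_has_vector_derivative_AE:
  assumes f: "integrable lborel f"
  shows "AE x in lborel. (cumul f has_vector_derivative f x) (at x)"
proof -
  have fi: "f integrable_on cbox a b" for a b
    by (rule integrable_on_subcbox[OF integrable_on_lborel[OF f]]) simp
  have fi': "(\<lambda>t. f (-t)) integrable_on cbox a b" for a b :: real
    using fi[of "-b" "-a"] Henstock_Kurzweil_Integration.integrable_reflect_real[where f=f and a="-b" and b="-a"] by simp
  obtain N where N: "negligible N" "\<And>x e. x \<notin> N \<Longrightarrow> 0 < e \<Longrightarrow>
      \<exists>d>0. \<forall>h. 0 < h \<and> h < d \<longrightarrow> norm (integral {x..x+h} f /\<^sub>R h - f x) < e"
    using integrable_ccontinuous_explicit[of f] fi by (auto simp: cbox_interval)
  obtain N' where N': "negligible N'" "\<And>x e. x \<notin> N' \<Longrightarrow> 0 < e \<Longrightarrow>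
      \<exists>d>0. \<forall>h. 0 < h \<and> h < d \<longrightarrow> norm (integral {x..x+h} (\<lambda>t. f (-t)) /\<^sub>R h - f (-x)) < e"
    using integrable_ccontinuous_explicit[of "\<lambda>t. f (-t)"] fi' by (auto simp: cbox_interval)
  \<comment> \<open>\<open>N'\<close> is exceptional for the reflected function and has to be
    reflected back; the image of a negligible set under a differentiable map is negligible.\<close>
  have neg: "negligible (N \<union> uminus ` N')"
    using N(1) N'(1) negligible_differentiable_image_negligible[of N' uminus]
    by (auto intro!: negligible_Un differentiable_on_minus differentiable_on_ident)
  have der: "(cumul f has_vector_derivative f x) (at x)" if x: "x \<notin> N \<union> uminus ` N'" for x
    unfolding has_vector_derivative_def has_derivative_at_alt
  proof (intro conjI allI impI bounded_linear_scaleR_left)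
    fix e :: real assume "e > 0"
    obtain d where d: "d > 0" "\<And>h. 0 < h \<Longrightarrow> h < d \<Longrightarrow> norm (integral {x..x+h} f /\<^sub>R h - f x) < e"
      using N(2)[of x e] x \<open>e > 0\<close> by auto
    have "-x \<notin> N'" using x by force
    then obtain d' where d': "d' > 0"
      "\<And>h. 0 < h \<Longrightarrow> h < d' \<Longrightarrow> norm (integral {-x..-x+h} (\<lambda>t. f (-t)) /\<^sub>R h - f x) < e"
      using N'(2)[of "-x" e] \<open>e > 0\<close> by auto
    \<comment> \<open>Turns the bound on the difference quotient into the increment form of
      \<open>has_derivative_at_alt\<close>; it serves the right and the left side.\<close>
    have scale: "norm (I - h *\<^sub>R c) \<le> e * h" if "norm (I /\<^sub>R h - c) < e" "h > 0" for I c :: complex and h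
    proof -
      have "I - h *\<^sub>R c = h *\<^sub>R (I /\<^sub>R h - c)"
        using that by (simp add: scaleR_diff_right)
      then have "norm (I - h *\<^sub>R c) = h * norm (I /\<^sub>R h - c)" using that by simp
      then show ?thesis using that by (simp add: mult.commute)
    qed
    show "\<exists>d>0. \<forall>y. norm (y - x) < d \<longrightarrow>
      norm (cumul f y - cumul f x - (y - x) *\<^sub>R f x) \<le> e * norm (y - x)"
    proof (intro exI[of _ "min d d'"] conjI allI impI)
      fix y assume y: "norm (y - x) < min d d'"
      consider "y = x" | "y > x" | "y < x" by linarith
      then show "norm (cumul f y - cumul f x - (y - x) *\<^sub>R f x) \<le> e * norm (y - x)"
      proof cases
        case 2
        with scale[OF d(2)[of "y - x"]] y cumul_increment_HK[OF f, of x y] show ?thesis by simp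
      next
        case 3
        have "integral {-x..-y} (\<lambda>t. f (-t)) = integral {y..x} f"
          by (rule Henstock_Kurzweil_Integration.integral_reflect_real)
        with 3 scale[OF d'(2)[of "x - y"]] y cumul_increment_HK[OF f, of y x]
        have "norm (cumul f x - cumul f y - (x - y) *\<^sub>R f x) \<le> e * (x - y)" by simp
        moreover have "cumul f y - cumul f x - (y - x) *\<^sub>R f x = - (cumul f x - cumul f y - (x - y) *\<^sub>R f x)"
          by (simp add: algebra_simps)
        ultimately show ?thesis using 3 by (simp only: norm_minus_cancel) simp
      qed simp
    qed (use d d' in auto)
  qed
  \<comment> \<open>Negligible sets are null for the completed measure, so the statement is first
    made there and then moved to \<open>lborel\<close>.\<close>
  have "AE x in lebesgue. x \<notin> N \<union> uminus ` N'"
    using neg AE_not_in negligible_iff_null_sets by blast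
  then have "AE x in lborel. x \<notin> N \<union> uminus ` N'"
    by (simp only: AE_completion_iff)
  then show ?thesis
    by (rule AE_mp) (use der in \<open>auto intro!: AE_I2\<close>)
qed

section \<open>Calculus of absolutely continuous functions\<close>

lemma AC_loc_add:
  assumes "AC_loc f" "AC_loc g"
  shows "AC_loc (\<lambda>x. f x + g x)"
  unfolding AC_loc_def ac_on_def
proof (intro allI impI)
  fix b \<epsilon> :: real
  assume b: "b \<ge> 0" and e: "\<epsilon> > 0"
  let ?P = "\<lambda>n u v. (\<forall>i<n. 0 \<le> u i \<and> u i \<le> v i \<and> v i \<le> b) \<and>
      (\<forall>i<n. \<forall>j<n. i \<noteq> j \<longrightarrow> v i \<le> u j \<or> v j \<le> u i)"
  obtain d1 where d1: "d1 > 0" "\<forall>(n::nat) u v. ?P n u v \<and> (\<Sum>i<n. v i - u i) < d1 \<longrightarrow> (\<Sum>i<n. cmod (f (v i) - f (u i))) < \<epsilon>/2"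
    using assms(1)[unfolded AC_loc_def ac_on_def, rule_format, OF b, of "\<epsilon>/2"] e by (auto simp: conj_assoc)
  obtain d2 where d2: "d2 > 0" "\<forall>(n::nat) u v. ?P n u v \<and> (\<Sum>i<n. v i - u i) < d2 \<longrightarrow> (\<Sum>i<n. cmod (g (v i) - g (u i))) < \<epsilon>/2"
    using assms(2)[unfolded AC_loc_def ac_on_def, rule_format, OF b, of "\<epsilon>/2"] e by (auto simp: conj_assoc)
  show "\<exists>\<delta>>0. \<forall>(n::nat) u v. (\<forall>i<n. 0 \<le> u i \<and> u i \<le> v i \<and> v i \<le> b) \<and>
      (\<forall>i<n. \<forall>j<n. i \<noteq> j \<longrightarrow> v i \<le> u j \<or> v j \<le> u i) \<and> (\<Sum>i<n. v i - u i) < \<delta> \<longrightarrow>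
      (\<Sum>i<n. cmod (f (v i) + g (v i) - (f (u i) + g (u i)))) < \<epsilon>"
  proof (intro exI[of _ "min d1 d2"] conjI allI impI)
    fix n :: nat and u v :: "nat \<Rightarrow> real"
    assume a: "(\<forall>i<n. 0 \<le> u i \<and> u i \<le> v i \<and> v i \<le> b) \<and>
      (\<forall>i<n. \<forall>j<n. i \<noteq> j \<longrightarrow> v i \<le> u j \<or> v j \<le> u i) \<and> (\<Sum>i<n. v i - u i) < min d1 d2"
    have "(\<Sum>i<n. cmod (f (v i) - f (u i))) < \<epsilon>/2" "(\<Sum>i<n. cmod (g (v i) - g (u i))) < \<epsilon>/2"
      using d1(2)[rule_format, of n u v] d2(2)[rule_format, of n u v] a by auto
    moreover have "(\<Sum>i<n. cmod (f (v i) + g (v i) - (f (u i) + g (u i)))) \<le>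
        (\<Sum>i<n. cmod (f (v i) - f (u i)) + cmod (g (v i) - g (u i)))"
      by (intro sum_mono norm_diff_triangle_ineq)
    ultimately show "(\<Sum>i<n. cmod (f (v i) + g (v i) - (f (u i) + g (u i)))) < \<epsilon>"
      by (simp add: sum.distrib)
  qed (use d1 d2 in auto)
qed

text \<open>Continuity bounds the factors on [0, b] by \<open>F\<close> and \<open>G\<close>, and
  the increment of the product splits as f(v) (g(v) - g(u)) + g(u) (f(v) - f(u)). Each half then
  gets \<epsilon>/2.\<close>

lemma AC_loc_mult:
  assumes "AC_loc f" "AC_loc g" and cont: "continuous_on UNIV f" "continuous_on UNIV g"
  shows "AC_loc (\<lambda>x. f x * g x)"
  unfolding AC_loc_def ac_on_def
proof (intro allI impI)
  fix b \<epsilon> :: real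
  assume b: "b \<ge> 0" and e: "\<epsilon> > 0"
  let ?P = "\<lambda>n u v. (\<forall>i<n. 0 \<le> u i \<and> u i \<le> v i \<and> v i \<le> b) \<and>
      (\<forall>i<n. \<forall>j<n. i \<noteq> j \<longrightarrow> v i \<le> u j \<or> v j \<le> u i)"
  have "\<exists>B>0. \<forall>x\<in>{0..b}. norm (h x) \<le> B" if "continuous_on UNIV h" for h :: "real \<Rightarrow> complex"
    using compact_imp_bounded[OF compact_continuous_image[OF continuous_on_subset[OF that], of "{0..b}"]]
    by (auto simp: bounded_pos)
  then obtain F G where F: "F > 0" "\<And>x. x \<in> {0..b} \<Longrightarrow> norm (f x) \<le> F"
      and G: "G > 0" "\<And>x. x \<in> {0..b} \<Longrightarrow> norm (g x) \<le> G"
    using cont by meson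
  obtain d1 where d1: "d1 > 0" "\<forall>(n::nat) u v. ?P n u v \<and> (\<Sum>i<n. v i - u i) < d1 \<longrightarrow> (\<Sum>i<n. cmod (f (v i) - f (u i))) < \<epsilon>/(2*G)"
    using assms(1)[unfolded AC_loc_def ac_on_def, rule_format, OF b, of "\<epsilon>/(2*G)"] e G by (auto simp: conj_assoc)
  obtain d2 where d2: "d2 > 0" "\<forall>(n::nat) u v. ?P n u v \<and> (\<Sum>i<n. v i - u i) < d2 \<longrightarrow> (\<Sum>i<n. cmod (g (v i) - g (u i))) < \<epsilon>/(2*F)"
    using assms(2)[unfolded AC_loc_def ac_on_def, rule_format, OF b, of "\<epsilon>/(2*F)"] e F by (auto simp: conj_assoc)
  show "\<exists>\<delta>>0. \<forall>(n::nat) u v. (\<forall>i<n. 0 \<le> u i \<and> u i \<le> v i \<and> v i \<le> b) \<and>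
      (\<forall>i<n. \<forall>j<n. i \<noteq> j \<longrightarrow> v i \<le> u j \<or> v j \<le> u i) \<and> (\<Sum>i<n. v i - u i) < \<delta> \<longrightarrow>
      (\<Sum>i<n. cmod (f (v i) * g (v i) - f (u i) * g (u i))) < \<epsilon>"
  proof (intro exI[of _ "min d1 d2"] conjI allI impI)
    fix n :: nat and u v :: "nat \<Rightarrow> real"
    assume a: "(\<forall>i<n. 0 \<le> u i \<and> u i \<le> v i \<and> v i \<le> b) \<and>
      (\<forall>i<n. \<forall>j<n. i \<noteq> j \<longrightarrow> v i \<le> u j \<or> v j \<le> u i) \<and> (\<Sum>i<n. v i - u i) < min d1 d2"
    have fg: "(\<Sum>i<n. cmod (f (v i) - f (u i))) < \<epsilon>/(2*G)" "(\<Sum>i<n. cmod (g (v i) - g (u i))) < \<epsilon>/(2*F)"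
      using d1(2)[rule_format, of n u v] d2(2)[rule_format, of n u v] a by auto
    have "(\<Sum>i<n. cmod (f (v i) * g (v i) - f (u i) * g (u i))) \<le>
        (\<Sum>i<n. F * cmod (g (v i) - g (u i)) + G * cmod (f (v i) - f (u i)))"
    proof (rule sum_mono)
      fix i assume "i \<in> {..<n}"
      then have i: "v i \<in> {0..b}" "u i \<in> {0..b}" using a by force+
      have "f (v i) * g (v i) - f (u i) * g (u i) = f (v i) * (g (v i) - g (u i)) + g (u i) * (f (v i) - f (u i))"
        by (simp add: algebra_simps)
      then have "cmod (f (v i) * g (v i) - f (u i) * g (u i)) \<le>
          cmod (f (v i)) * cmod (g (v i) - g (u i)) + cmod (g (u i)) * cmod (f (v i) - f (u i))"
        by (metis norm_mult norm_triangle_ineq)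
      also have "\<dots> \<le> F * cmod (g (v i) - g (u i)) + G * cmod (f (v i) - f (u i))"
        using F(2)[OF i(1)] G(2)[OF i(2)] by (intro add_mono mult_right_mono) auto
      finally show "cmod (f (v i) * g (v i) - f (u i) * g (u i)) \<le> \<dots>" .
    qed
    also have "\<dots> = F * (\<Sum>i<n. cmod (g (v i) - g (u i))) + G * (\<Sum>i<n. cmod (f (v i) - f (u i)))"
      by (simp add: sum.distrib sum_distrib_left)
    also have "\<dots> < \<epsilon>"
    proof -
      have "F * (\<Sum>i<n. cmod (g (v i) - g (u i))) < F * (\<epsilon>/(2*F))"
        "G * (\<Sum>i<n. cmod (f (v i) - f (u i))) < G * (\<epsilon>/(2*G))"
        using fg F G by (simp_all only: mult_strict_left_mono)
      then show ?thesis using F G by simp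
    qed
    finally show "(\<Sum>i<n. cmod (f (v i) * g (v i) - f (u i) * g (u i))) < \<epsilon>" .
  qed (use d1 d2 in auto)
qed

text \<open>On [0, b] the derivative is bounded by some \<open>B\<close>, so the mean value
  inequality makes \<open>f\<close> Lipschitz there and \<delta> = \<epsilon>/B works.\<close>

lemma AC_loc_C1:
  assumes der: "\<And>x. (f has_vector_derivative f' x) (at x)" and cont: "continuous_on UNIV f'"
  shows "AC_loc f"
  unfolding AC_loc_def ac_on_def
proof (intro allI impI)
  fix b \<epsilon> :: real
  assume b: "b \<ge> 0" and e: "\<epsilon> > 0"
  obtain B where B: "B > 0" "\<And>x. x \<in> {0..b} \<Longrightarrow> norm (f' x) \<le> B"
    using compact_imp_bounded[OF compact_continuous_image[OF continuous_on_subset[OF cont], of "{0..b}"]]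
    by (auto simp: bounded_pos)
  have lip: "norm (f y - f x) \<le> B * (y - x)" if "0 \<le> x" "x \<le> y" "y \<le> b" for x y
  proof (cases "x = y")
    case False
    then have "x < y" using that by simp
    moreover have "continuous_on {x..y} f"
      using der by (intro continuous_at_imp_continuous_on ballI has_vector_derivative_continuous)
    ultimately obtain z where z: "z \<in> {x<..<y}" "norm (f y - f x) \<le> norm ((y - x) *\<^sub>R f' z)"
      using mvt_general[of x y f "\<lambda>z h. h *\<^sub>R f' z"] der unfolding has_vector_derivative_def by blast
    have "norm ((y - x) *\<^sub>R f' z) \<le> B * (y - x)"
      using B(2)[of z] z(1) that by (simp add: mult.commute mult_right_mono)
    with z(2) show ?thesis by linarith
  qed simp
  show "\<exists>\<delta>>0. \<forall>(n::nat) u v. (\<forall>i<n. 0 \<le> u i \<and> u i \<le> v i \<and> v i \<le> b) \<and>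
      (\<forall>i<n. \<forall>j<n. i \<noteq> j \<longrightarrow> v i \<le> u j \<or> v j \<le> u i) \<and> (\<Sum>i<n. v i - u i) < \<delta> \<longrightarrow>
      (\<Sum>i<n. cmod (f (v i) - f (u i))) < \<epsilon>"
  proof (intro exI[of _ "\<epsilon>/B"] conjI allI impI)
    fix n :: nat and u v :: "nat \<Rightarrow> real"
    assume a: "(\<forall>i<n. 0 \<le> u i \<and> u i \<le> v i \<and> v i \<le> b) \<and>
      (\<forall>i<n. \<forall>j<n. i \<noteq> j \<longrightarrow> v i \<le> u j \<or> v j \<le> u i) \<and> (\<Sum>i<n. v i - u i) < \<epsilon>/B"
    have "(\<Sum>i<n. cmod (f (v i) - f (u i))) \<le> (\<Sum>i<n. B * (v i - u i))"
      using a by (intro sum_mono lip) auto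
    also have "\<dots> = B * (\<Sum>i<n. v i - u i)" by (simp add: sum_distrib_left)
    also have "\<dots> < B * (\<epsilon>/B)" using a B by (intro mult_strict_left_mono) auto
    finally show "(\<Sum>i<n. cmod (f (v i) - f (u i))) < \<epsilon>" using B by simp
  qed (use e B in auto)
qed

lemma ae_deriv_mult:
  assumes "ae_deriv f f'" "ae_deriv g g'"
  shows "ae_deriv (\<lambda>x. f x * g x) (\<lambda>x. f x * g' x + f' x * g x)"
  using assms unfolding ae_deriv_def
  by eventually_elim (auto intro: has_vector_derivative_mult)

lemma ae_deriv_add:
  assumes "ae_deriv f f'" "ae_deriv g g'"
  shows "ae_deriv (\<lambda>x. f x + g x) (\<lambda>x. f' x + g' x)"
  using assms unfolding ae_deriv_def
  by eventually_elim (auto intro: has_vector_derivative_add)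

lemma ae_deriv_everywhere:
  assumes "\<And>x. (f has_vector_derivative f' x) (at x)"
  shows "ae_deriv f f'"
  using assms unfolding ae_deriv_def by simp

lemma ae_deriv_cumul: "integrable lborel f \<Longrightarrow> ae_deriv (cumul f) f"
  unfolding ae_deriv_def by (rule AE_mp[OF cumul_has_vector_derivative_AE]) auto

section \<open>The cutoff function\<close>

text \<open>An exponent of at least 2 leaves a positive power of \<open>max 0 s\<close> in the
  derivative, which smooths the corner at 0.\<close>

lemma DERIV_max_0_power:
  "((\<lambda>s::real. max 0 s ^ Suc (Suc n)) has_real_derivative real (Suc (Suc n)) * max 0 s ^ Suc n) (at s)"
proof -
  consider "s > 0" | "s < 0" | "s = 0" by linarith
  then show ?thesis
  proof cases
    case 1
    have "((\<lambda>s::real. s ^ Suc (Suc n)) has_real_derivative real (Suc (Suc n)) * s ^ Suc n) (at s)"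
      using DERIV_pow[of "Suc (Suc n)" s] by simp
    then have "((\<lambda>s::real. max 0 s ^ Suc (Suc n)) has_real_derivative real (Suc (Suc n)) * s ^ Suc n) (at s)"
      by (rule has_field_derivative_transform_within_open[where S="{0<..}"]) (use 1 in auto)
    then show ?thesis using 1 by (simp add: max_def)
  next
    case 2
    have "((\<lambda>s::real. 0) has_real_derivative 0) (at s)" by simp
    then have "((\<lambda>s::real. max 0 s ^ Suc (Suc n)) has_real_derivative 0) (at s)"
      by (rule has_field_derivative_transform_within_open[where S="{..<0}"]) (use 2 in auto)
    then show ?thesis using 2 by (simp add: max_def)
  next
    case 3
    \<comment> \<open>Caratheodory's criterion at 0: one factor \<open>z\<close> splits off and the
      remaining power is the continuous slope function, with value 0 at 0.\<close>
    have "isCont (\<lambda>z::real. max 0 z ^ Suc n) 0"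
      by (intro continuous_intros)
    moreover have "max 0 z ^ Suc (Suc n) = max 0 z ^ Suc n * z" for z :: real
      by (simp add: max_def)
    ultimately show ?thesis unfolding CARAT_DERIV 3
      by (intro exI[of _ "\<lambda>z::real. max 0 z ^ Suc n"]) simp
  qed
qed

text \<open>The cutoff will be the cube of this truncated parabola: 3 is the least integer power
  whose second derivative is still continuous at \<open>a\<close> and \<open>b\<close>.\<close>

definition hump :: "real \<Rightarrow> real \<Rightarrow> real \<Rightarrow> real" where
  "hump a b x = max 0 ((x - a) * (b - x))"

lemma hump_eq_0:
  assumes "x \<notin> {a<..<b}" "a \<le> b"
  shows "hump a b x = 0"
proof -
  have "(x - a) * (b - x) \<le> 0"
    using assms by (cases "x \<le> a") (auto intro: mult_nonpos_nonneg mult_nonneg_nonpos)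
  then show ?thesis by (simp add: hump_def)
qed

text \<open>Inside the interval both factors of the parabola and |a + b - 2x| are at most b - a <=
  1. The last bound carries the factor \<open>hump a b x\<close> because |a + b - 2x| alone is
  unbounded on the line.\<close>

lemma hump_bounds:
  assumes "a \<le> b" "b - a \<le> 1"
  shows "0 \<le> hump a b x" "hump a b x \<le> 1" "hump a b x * \<bar>a + b - 2 * x\<bar> \<le> hump a b x"
proof -
  show 0: "0 \<le> hump a b x" by (simp add: hump_def)
  show "hump a b x \<le> 1"
  proof (cases "x \<in> {a<..<b}")
    case True
    then have "(x - a) * (b - x) \<le> 1 * 1" using assms by (intro mult_mono) auto
    then show ?thesis by (simp add: hump_def)
  qed (use hump_eq_0 assms in simp)
  show "hump a b x * \<bar>a + b - 2 * x\<bar> \<le> hump a b x"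
  proof (cases "x \<in> {a<..<b}")
    case True
    then show ?thesis using assms 0 mult_left_mono[of "\<bar>a + b - 2 * x\<bar>" 1 "hump a b x"] by auto
  qed (use hump_eq_0 assms in simp)
qed

lemma continuous_hump [continuous_intros]: "continuous_on S (hump a b)"
  unfolding hump_def[abs_def] by (intro continuous_intros)

lemma DERIV_hump_cubed:
  "((\<lambda>x. hump a b x ^ 3) has_real_derivative 3 * hump a b x ^ 2 * (a + b - 2 * x)) (at x)"
proof -
  have "((\<lambda>s::real. max 0 s ^ 3) has_real_derivative 3 * max 0 ((x - a) * (b - x)) ^ 2) (at ((x - a) * (b - x)))"
    using DERIV_max_0_power[of 1 "(x - a) * (b - x)"] by (simp add: numeral_eq_Suc)
  moreover have "((\<lambda>x. (x - a) * (b - x)) has_real_derivative a + b - 2 * x) (at x)"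
    by (auto intro!: derivative_eq_intros)
  ultimately show ?thesis unfolding hump_def by (rule DERIV_chain2)
qed

lemma DERIV_hump_squared:
  "((\<lambda>x. hump a b x ^ 2) has_real_derivative 2 * hump a b x * (a + b - 2 * x)) (at x)"
proof -
  have "((\<lambda>s::real. max 0 s ^ 2) has_real_derivative 2 * max 0 ((x - a) * (b - x))) (at ((x - a) * (b - x)))"
    using DERIV_max_0_power[of 0 "(x - a) * (b - x)"] by (simp add: numeral_eq_Suc)
  moreover have "((\<lambda>x. (x - a) * (b - x)) has_real_derivative a + b - 2 * x) (at x)"
    by (auto intro!: derivative_eq_intros)
  ultimately show ?thesis unfolding hump_def by (rule DERIV_chain2)
qed

lemma DERIV2_hump_cubed:
  "((\<lambda>x. 3 * hump a b x ^ 2 * (a + b - 2 * x)) has_real_derivative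
    6 * hump a b x * (a + b - 2 * x)^2 - 6 * hump a b x ^ 2) (at x)"
  by (rule derivative_eq_intros DERIV_hump_squared refl)+ (simp add: power2_eq_square algebra_simps)

section \<open>The Volterra equation\<close>

text \<open>In the sup norm, multiplying by \<open>p\<close> and integrating has operator norm at
  most the total mass of \<open>p\<close>. This and its counterpart for indicators drive the
  contraction estimate.\<close>

lemma integrable_mult_bounded:
  fixes p W :: "real \<Rightarrow> complex"
  assumes p: "integrable lborel p" and W: "continuous_on UNIV W" "\<And>x. norm (W x) \<le> M"
  shows "integrable lborel (\<lambda>s. p s * W s)"
    and "(LINT s|lborel. norm (p s * W s)) \<le> (LINT s|lborel. norm (p s)) * M"
proof -
  have [measurable]: "W \<in> borel_measurable borel" using W(1) by (rule borel_measurable_continuous_onI)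
  have [measurable]: "p \<in> borel_measurable borel" using p by simp
  have "0 \<le> M" using W(2)[of 0] norm_ge_zero order_trans by blast
  show 1: "integrable lborel (\<lambda>s. p s * W s)"
  proof (rule Bochner_Integration.integrable_bound)
    show "integrable lborel (\<lambda>s. M *\<^sub>R p s)" using p by simp
    show "AE s in lborel. norm (p s * W s) \<le> norm (M *\<^sub>R p s)"
      using \<open>0 \<le> M\<close> W(2) by (intro AE_I2) (simp add: norm_mult mult.commute[of M] mult_left_mono)
  qed simp
  have "(LINT s|lborel. norm (p s * W s)) \<le> (LINT s|lborel. norm (p s) * M)"
    using integrable_norm[OF 1] p W(2) by (intro integral_mono) (auto simp: norm_mult intro!: mult_left_mono)
  then show "(LINT s|lborel. norm (p s * W s)) \<le> (LINT s|lborel. norm (p s)) * M" by simp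
qed

lemma integrable_indicator_bounded:
  fixes W :: "real \<Rightarrow> complex"
  assumes d: "a \<le> b" and W: "continuous_on UNIV W" "\<And>x. norm (W x) \<le> M"
  shows "integrable lborel (\<lambda>s. indicator {a..b} s * W s)"
    and "(LINT s|lborel. norm (indicator {a..b} s * W s)) \<le> (b - a) * M"
proof -
  have "integrable lborel (\<lambda>s. complex_of_real (indicator {a..b} s))"
    by (intro integrable_of_real integrable_real_indicator) (use d in auto)
  then have i: "integrable lborel (\<lambda>s. indicator {a..b} s :: complex)" by (simp only: of_real_indicator)
  have "(LINT s|lborel. norm (indicator {a..b} s :: complex)) = (LINT s|lborel. indicator {a..b} s)"
    by (intro Bochner_Integration.integral_cong) (auto simp: indicator_def)
  then have "(LINT s|lborel. norm (indicator {a..b} s :: complex)) = b - a" using d by simp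
  then show "integrable lborel (\<lambda>s. indicator {a..b} s * W s)"
    "(LINT s|lborel. norm (indicator {a..b} s * W s)) \<le> (b - a) * M"
    using integrable_mult_bounded[OF i W] by simp_all
qed

text \<open>Banach's fixed point theorem in the space of bounded continuous functions. The double
  integration has norm at most 1/4, so the fixed point has sup norm at most 1 + 1/4 of itself, that
  is at most 4/3, and hence differs from 1 by at most 1/3.\<close>

lemma Volterra_solution:
  assumes p: "integrable lborel p" and ab: "a \<le> b"
    and small: "(LINT t|lborel. norm (p t)) * (b - a) \<le> 1/4"
  shows "\<exists>U. continuous_on UNIV U \<and> (\<forall>x. norm (U x - 1) \<le> 1/3) \<and>
    U = (\<lambda>x. 1 + cumul (\<lambda>t. indicator {a..b} t * cumul (\<lambda>s. p s * U s) t) x)"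
proof -
  define K where "K = (LINT t|lborel. norm (p t))"
  define V where "V W = cumul (\<lambda>s. p s * W s)" for W :: "real \<Rightarrow> complex"
  \<comment> \<open>\<open>V W\<close> is merely bounded on the line; the indicator keeps its
    integral finite, with the factor b - a.\<close>
  define J where "J f = cumul (\<lambda>t. indicator {a..b} t * f t)" for f :: "real \<Rightarrow> complex"
  have K: "K \<ge> 0" "K * (b - a) \<le> 1/4" using small by (simp_all add: K_def)
  have V: "continuous_on UNIV (V W)" "norm (V W x) \<le> K * norm W" for W :: "real \<Rightarrow>\<^sub>C complex" and x
  proof -
    note * = integrable_mult_bounded[OF p continuous_on_apply_bcontfun norm_bounded]
    show "continuous_on UNIV (V W)" unfolding V_def by (rule continuous_cumul[OF *(1)])
    show "norm (V W x) \<le> K * norm W"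
      unfolding V_def K_def by (rule order_trans[OF norm_cumul_le[OF *(1)] *(2)])
  qed
  have JV: "continuous_on UNIV (J (V W))" "norm (J (V W) x) \<le> norm W / 4"
    "integrable lborel (\<lambda>s. indicator {a..b} s * V W s)" for W :: "real \<Rightarrow>\<^sub>C complex" and x
  proof -
    note * = integrable_indicator_bounded[OF ab V]
    show "integrable lborel (\<lambda>s. indicator {a..b} s * V W s)" by (rule *(1))
    show "continuous_on UNIV (J (V W))" unfolding J_def by (rule continuous_cumul[OF *(1)])
    have "norm (J (V W) x) \<le> (b - a) * (K * norm W)"
      unfolding J_def by (rule order_trans[OF norm_cumul_le[OF *(1)] *(2)])
    also have "\<dots> = (K * (b - a)) * norm W" by simp
    also have "\<dots> \<le> 1/4 * norm W" using K by (intro mult_right_mono) auto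
    finally show "norm (J (V W) x) \<le> norm W / 4" by simp
  qed
  define T where "T W = Bcontfun (\<lambda>x. 1 + J (V W) x)" for W :: "real \<Rightarrow>\<^sub>C complex"
  have T: "apply_bcontfun (T W) x = 1 + J (V W) x" for W x
  proof -
    have "(\<lambda>x. 1 + J (V W) x) \<in> bcontfun"
    proof (rule bcontfun_normI)
      show "norm (1 + J (V W) x) \<le> 1 + norm W / 4" for x
        using norm_triangle_ineq[of 1 "J (V W) x"] JV(2)[of W x] by simp
    qed (intro continuous_intros JV)
    then show ?thesis unfolding T_def by (simp add: Bcontfun_inverse)
  qed
  \<comment> \<open>Linearity of the double integration turns its norm bound into the Lipschitz
    constant 1/4 of \<open>T\<close>.\<close>
  have JV_diff: "J (V W) x - J (V W') x = J (V (W - W')) x" for W W' :: "real \<Rightarrow>\<^sub>C complex" and x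
  proof -
    have "V W t - V W' t = V (W - W') t" for t
    proof -
      have "V W t - V W' t = cumul (\<lambda>s. p s * W s - p s * W' s) t"
        unfolding V_def
        by (intro cumul_diff integrable_mult_bounded[OF p continuous_on_apply_bcontfun norm_bounded])
      then show ?thesis by (simp add: V_def right_diff_distrib)
    qed
    then have "(\<lambda>t. indicator {a..b} t * V (W - W') t) = (\<lambda>t. indicator {a..b} t * V W t - indicator {a..b} t * V W' t)"
      by (auto simp: right_diff_distrib[symmetric])
    then show ?thesis
      unfolding J_def using cumul_diff[OF JV(3) JV(3)] by simp
  qed
  have "dist (T W) (T W') \<le> 1/4 * dist W W'" for W W'
  proof (rule dist_bound)
    fix x
    have "dist (T W x) (T W' x) = norm (J (V (W - W')) x)"
      by (simp add: T dist_norm JV_diff)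
    also have "\<dots> \<le> 1/4 * dist W W'" using JV(2)[of "W - W'" x] by (simp add: dist_norm)
    finally show "dist (T W x) (T W' x) \<le> 1/4 * dist W W'" .
  qed
  then have "\<exists>!W. T W = W"
    by (intro banach_fix_type[of "1/4"]) auto
  then obtain W where W: "T W = W" by blast
  have eq: "W x = 1 + J (V W) x" for x using T[of W x] W by simp
  have "norm W \<le> 1 + norm W / 4"
  proof (rule norm_bound)
    show "norm (W x) \<le> 1 + norm W / 4" for x
      using norm_triangle_ineq[of 1 "J (V W) x"] JV(2)[of W x] eq[of x] by simp
  qed
  then have nW: "norm W \<le> 4/3" by simp
  show ?thesis
  proof (intro exI[of _ "apply_bcontfun W"] conjI allI)
    show "norm (W x - 1) \<le> 1/3" for x
      using JV(2)[of W x] eq[of x] nW by simp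
    show "apply_bcontfun W = (\<lambda>x. 1 + cumul (\<lambda>t. indicator {a..b} t * cumul (\<lambda>s. p s * W s) t) x)"
      using eq unfolding J_def V_def by (rule ext)
  qed simp
qed

section \<open>Estimates for the norm\<close>

lemma cont_bounded_support_L2p:
  assumes f: "continuous_on UNIV f" and bd: "\<And>x. cmod (f x) \<le> M" and supp: "\<And>x. x \<notin> {a..b} \<Longrightarrow> f x = 0"
  shows "f \<in> L2p" and "a \<le> b \<Longrightarrow> l2norm f \<le> M * sqrt (b - a)"
proof -
  have [measurable]: "f \<in> borel_measurable borel" using f by (rule borel_measurable_continuous_onI)
  have M: "0 \<le> M" using bd[of 0] norm_ge_zero order_trans by blast
  have le: "(cmod (f x))\<^sup>2 \<le> M\<^sup>2 * indicator {a..b} x" for x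
    using bd[of x] supp[of x] by (auto simp: indicator_def intro: power_mono)
  have bi: "integrable lborel (\<lambda>x. M\<^sup>2 * indicator {a..b} x :: real)"
    by (cases "a \<le> b") (auto intro!: integrable_mult_right integrable_real_indicator)
  have i: "set_integrable lborel {0..} (\<lambda>x. (cmod (f x))\<^sup>2)"
    unfolding set_integrable_def
  proof (rule Bochner_Integration.integrable_bound[OF bi])
    show "AE x in lborel. norm (indicator {0..} x *\<^sub>R (cmod (f x))\<^sup>2) \<le> norm (M\<^sup>2 * indicator {a..b} x :: real)"
    proof (rule AE_I2)
      show "norm (indicator {0..} x *\<^sub>R (cmod (f x))\<^sup>2) \<le> norm (M\<^sup>2 * indicator {a..b} x :: real)" for x
        using le[of x] by (auto simp: indicator_def)
    qed
  qed simp
  then show "f \<in> L2p" by (simp add: L2p_def set_borel_measurable_def)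
  assume ab: "a \<le> b"
  have "(LINT x:{0..}|lborel. (cmod (f x))\<^sup>2) \<le> (LINT x|lborel. M\<^sup>2 * indicator {a..b} x)"
    unfolding set_lebesgue_integral_def
  proof (rule integral_mono[OF _ bi])
    show "integrable lborel (\<lambda>x. indicator {0..} x *\<^sub>R (cmod (f x))\<^sup>2)" using i by (simp add: set_integrable_def)
    show "indicator {0..} x *\<^sub>R (cmod (f x))\<^sup>2 \<le> M\<^sup>2 * indicator {a..b} x" for x
      using le[of x] by (auto simp: indicator_def split: if_splits)
  qed
  also have "\<dots> = M\<^sup>2 * (b - a)" using ab by simp
  finally show "l2norm f \<le> M * sqrt (b - a)"
    unfolding l2norm_def using M real_sqrt_le_mono by (fastforce simp: real_sqrt_mult)
qed

text \<open>Measurability is known only after multiplication by the indicator, which is therefore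
  distributed over the difference.\<close>

lemma set_borel_measurable_diff_scaled:
  fixes f g :: "real \<Rightarrow> complex"
  assumes "set_borel_measurable lborel A f" "set_borel_measurable lborel A g"
  shows "set_borel_measurable lborel A (\<lambda>x. f x - c * g x)"
proof -
  have "(\<lambda>x. indicator A x *\<^sub>R (f x - c * g x)) = (\<lambda>x. indicator A x *\<^sub>R f x - c * (indicator A x *\<^sub>R g x))"
    by (auto simp: indicator_def)
  moreover have "\<dots> \<in> borel_measurable lborel"
    using assms unfolding set_borel_measurable_def by (intro borel_measurable_diff borel_measurable_times) auto
  ultimately show ?thesis unfolding set_borel_measurable_def by (simp only:)
qed

text \<open>Carries norms from the test functions to their representatives in the extension, which
  agree with them only almost everywhere on the half-line.\<close>

lemma l2norm_cong_AE:
  assumes "set_borel_measurable lborel {0..} f" "set_borel_measurable lborel {0..} g" and "f \<doteq> g"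
  shows "l2norm f = l2norm g"
proof -
  have m: "(\<lambda>x. indicator {0..} x *\<^sub>R (cmod (u x))\<^sup>2) \<in> borel_measurable lborel"
    if "set_borel_measurable lborel {0..} u" for u
  proof -
    have "(\<lambda>x. indicator {0..} x *\<^sub>R (cmod (u x))\<^sup>2) = (\<lambda>x. (cmod (indicator {0..} x *\<^sub>R u x))\<^sup>2)"
      by (auto simp: indicator_def)
    moreover have "\<dots> \<in> borel_measurable lborel"
      using that unfolding set_borel_measurable_def
      by (intro borel_measurable_power borel_measurable_norm[THEN measurable_compose[rotated]])
    ultimately show ?thesis by (simp only:)
  qed
  have "(LINT x:{0..}|lborel. (cmod (f x))\<^sup>2) = (LINT x:{0..}|lborel. (cmod (g x))\<^sup>2)"
    unfolding set_lebesgue_integral_def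
    by (rule integral_cong_AE[OF m m], fact, fact)
       (use assms(3) in \<open>auto simp: ae_eq_def indicator_def elim!: eventually_mono\<close>)
  then show ?thesis by (simp add: l2norm_def)
qed

lemma l2norm_lower_bound:
  assumes f: "f \<in> L2p" and a: "0 \<le> a" "a \<le> b" and k: "0 \<le> k" "\<And>x. x \<in> {a..b} \<Longrightarrow> k \<le> cmod (f x)"
  shows "k * sqrt (b - a) \<le> l2norm f"
proof -
  have "k\<^sup>2 * (b - a) = (LINT x|lborel. k\<^sup>2 * indicator {a..b} x)" using a by simp
  also have "\<dots> \<le> (LINT x:{0..}|lborel. (cmod (f x))\<^sup>2)"
    unfolding set_lebesgue_integral_def
  proof (rule integral_mono)
    show "integrable lborel (\<lambda>x. k\<^sup>2 * indicator {a..b} x :: real)"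
      using a by (auto intro!: integrable_mult_right integrable_real_indicator)
    show "integrable lborel (\<lambda>x. indicator {0..} x *\<^sub>R (cmod (f x))\<^sup>2)"
      using f by (simp add: L2p_def set_integrable_def)
    show "k\<^sup>2 * indicator {a..b} x \<le> indicator {0..} x *\<^sub>R (cmod (f x))\<^sup>2" for x
      using k(2)[of x] k(1) a by (auto simp: indicator_def intro: power_mono)
  qed
  finally have "sqrt (k\<^sup>2 * (b - a)) \<le> l2norm f" unfolding l2norm_def by (rule real_sqrt_le_mono)
  then show ?thesis using k(1) by (simp add: real_sqrt_mult)
qed

section \<open>Localized test functions\<close>

text \<open>With U'' = q U on the interval, the product of the cutoff and \<open>U\<close> satisfies
  l(y) = -X'' U - 2 X' U'. All bounds depend on \<open>d\<close> and \<open>C\<close> alone, not on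
  the position \<open>a\<close>, so they are uniform over the whole system of intervals.\<close>

lemma localized_test_function:
  assumes q: "L1loc q" and a: "0 \<le> a" and d: "0 < d" "d \<le> 1" and C: "0 \<le> C" "C * d \<le> 1/4"
    and small: "(LINT x:{a..a+d}|lborel. cmod (q x)) \<le> C"
  shows "\<exists>y g. (y, g) \<in> L0graph q \<and> continuous_on UNIV y \<and> continuous_on UNIV g \<and>
    (\<forall>x. x \<notin> {a<..<a+d} \<longrightarrow> y x = 0 \<and> g x = 0) \<and> (\<forall>x. cmod (y x) \<le> 2 \<and> cmod (g x) \<le> 24 + 12 * C) \<and>
    (\<forall>x\<in>{a+d/4..a+3*d/4}. 2/3 * (d\<^sup>2/16)^3 \<le> cmod (y x))"
proof -
  \<comment> \<open>The truncation is integrable on the whole line and vanishes to the left of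
    \<open>a\<close>, which encodes the initial data U(a) = 1 and U'(a) = 0.\<close>
  define p where "p t = indicator {a..a+d} t * q t" for t
  have "set_integrable lborel {0..a+d} q" using q a d by (simp add: L1loc_def)
  then have "set_integrable lborel {a..a+d} q"
    by (rule set_integrable_subset) (use a in auto)
  then have p: "integrable lborel p"
    unfolding set_integrable_def p_def[abs_def] by (simp add: scaleR_conv_of_real of_real_indicator)
  have "(LINT t|lborel. cmod (p t)) = (LINT x:{a..a+d}|lborel. cmod (q x))"
    unfolding set_lebesgue_integral_def p_def
    by (intro Bochner_Integration.integral_cong) (auto simp: indicator_def)
  with small have pC: "(LINT t|lborel. cmod (p t)) \<le> C" by simp
  have pd: "(LINT t|lborel. cmod (p t)) * (a + d - a) \<le> 1/4"
    using order_trans[OF mult_right_mono[OF pC, of d] C(2)] d by simp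
  have ab: "a \<le> a + d" using d by simp
  obtain U where U: "continuous_on UNIV U" "\<And>x. cmod (U x - 1) \<le> 1/3"
    and U_fix: "U = (\<lambda>x. 1 + cumul (\<lambda>t. indicator {a..a+d} t * cumul (\<lambda>s. p s * U s) t) x)"
    using Volterra_solution[OF p ab pd] by blast
  define V where "V = cumul (\<lambda>s. p s * U s)"
  define W where "W t = indicator {a..a+d} t * V t" for t
  have U_ub: "cmod (U x) \<le> 4/3" and U_lb: "2/3 \<le> cmod (U x)" for x
    using U(2)[of x] norm_triangle_sub[of "U x" 1] norm_triangle_sub[of 1 "U x"]
    by (auto simp: norm_minus_commute)
  note pU = integrable_mult_bounded[OF p U(1) U_ub]
  have V_cont: "continuous_on UNIV V" unfolding V_def by (rule continuous_cumul[OF pU(1)])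
  have V_bd: "cmod (V x) \<le> 2 * C" for x
  proof -
    have "cmod (V x) \<le> (LINT s|lborel. cmod (p s)) * (4/3)"
      unfolding V_def by (rule order_trans[OF norm_cumul_le[OF pU(1)] pU(2)])
    with pC C(1) show ?thesis by linarith
  qed
  have W: "integrable lborel W"
    unfolding W_def[abs_def] using integrable_indicator_bounded(1)[OF _ V_cont V_bd] d by simp
  have U_eq: "U = (\<lambda>x. 1 + cumul W x)" unfolding W_def[abs_def] V_def by (rule U_fix)
  have const_deriv: "((\<lambda>_. 1 :: complex) has_vector_derivative 0) (at x)" for x :: real
    by simp
  have U_AC: "AC_loc U"
    unfolding U_eq by (intro AC_loc_add AC_loc_cumul[OF W] AC_loc_C1[OF const_deriv]) simp
  have U_deriv: "ae_deriv U W"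
    using ae_deriv_add[OF ae_deriv_everywhere[OF const_deriv] ae_deriv_cumul[OF W]]
    unfolding U_eq by simp
  have V_AC: "AC_loc V" and V_deriv: "ae_deriv V (\<lambda>s. p s * U s)"
    unfolding V_def by (rule AC_loc_cumul[OF pU(1)] ae_deriv_cumul[OF pU(1)])+
  \<comment> \<open>\<open>V\<close> plays the role of \<open>U'\<close>, but only on \<open>[a, a + d]\<close>: outside, \<open>U\<close> is constant while \<open>V\<close>
    need not vanish. The factors \<open>X\<close> and \<open>X1\<close> below hide the difference between \<open>V\<close> and \<open>W\<close>.\<close>
  define s where "s x = a + (a + d) - 2 * x" for x
  define h where "h = hump a (a+d)"
  \<comment> \<open>The cutoff and, in \<open>X1\<close> and \<open>X2\<close>, its first two
    derivatives; \<open>s\<close> is the derivative of the parabola inside \<open>h\<close>.\<close>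
  define X where "X x = complex_of_real (h x ^ 3)" for x
  define X1 where "X1 x = complex_of_real (3 * h x ^ 2 * s x)" for x
  define X2 where "X2 x = complex_of_real (6 * h x * (s x)^2 - 6 * h x ^ 2)" for x
  have X_deriv: "(X has_vector_derivative X1 x) (at x)" and X1_deriv: "(X1 has_vector_derivative X2 x) (at x)" for x
    unfolding X_def[abs_def] X1_def[abs_def] X2_def h_def s_def
    by (intro has_vector_derivative_of_real DERIV_hump_cubed DERIV2_hump_cubed)+
  have h_cont: "continuous_on S h" for S unfolding h_def by (rule continuous_hump)
  have X_cont: "continuous_on UNIV X" "continuous_on UNIV X1" "continuous_on UNIV X2"
    unfolding X_def[abs_def] X1_def[abs_def] X2_def[abs_def] s_def by (intro continuous_intros h_cont)+
  have h0: "h x = 0" if "x \<notin> {a<..<a+d}" for x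
    unfolding h_def using hump_eq_0[OF that] d by simp
  have h: "0 \<le> h x" "h x \<le> 1" "h x * \<bar>s x\<bar> \<le> h x" for x
    using hump_bounds[of a "a+d" x] d unfolding h_def s_def by simp_all
  have hs: "h x * \<bar>s x\<bar> \<le> 1" for x using h[of x] by linarith
  have X_bd: "cmod (X x) \<le> 1" for x
    unfolding X_def using h[of x] by (simp add: norm_power power_le_one)
  have X1_bd: "cmod (X1 x) \<le> 3" for x
  proof -
    have "cmod (X1 x) = 3 * (h x * (h x * \<bar>s x\<bar>))"
      unfolding X1_def using h(1)[of x] by (simp add: norm_mult norm_power power2_eq_square abs_mult)
    also have "\<dots> \<le> 3 * (1 * 1)" using h[of x] hs[of x] by (intro mult_left_mono mult_mono) auto
    finally show ?thesis by simp
  qed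
  have X2_bd: "cmod (X2 x) \<le> 12" for x
  proof -
    \<comment> \<open>Off the interval \<open>s\<close> is unbounded, so each factor |s| is absorbed
      by \<open>h\<close>, which vanishes there.\<close>
    have "h x * (s x)\<^sup>2 = (h x * \<bar>s x\<bar>) * \<bar>s x\<bar>" by (simp add: power2_eq_square)
    also have "\<dots> \<le> h x * \<bar>s x\<bar>" using h[of x] by (intro mult_right_mono) auto
    finally have 1: "h x * (s x)\<^sup>2 \<le> 1" using hs[of x] by simp
    have 2: "0 \<le> h x * (s x)\<^sup>2" "0 \<le> (h x)\<^sup>2" "(h x)\<^sup>2 \<le> 1" using h[of x] by (auto simp: power_le_one)
    have "cmod (X2 x) = \<bar>6 * h x * (s x)\<^sup>2 - 6 * (h x)\<^sup>2\<bar>" unfolding X2_def by (rule norm_of_real)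
    also have "\<dots> \<le> 12" using 1 2 unfolding mult.assoc abs_le_iff by linarith
    finally show ?thesis .
  qed
  define y where "y x = X x * U x" for x
  define y1 where "y1 x = X1 x * U x + X x * V x" for x
  define y2 where "y2 x = X2 x * U x + 2 * X1 x * V x + X x * (q x * U x)" for x
  \<comment> \<open>This is l(y): the summand X q U of \<open>y2\<close> cancels against q y, so no
    bound on \<open>q\<close> itself enters.\<close>
  define g where "g x = - (X2 x * U x + 2 * X1 x * V x)" for x
  have XW: "X x * W x = X x * V x" for x
    using h0[of x] by (cases "x \<in> {a..a+d}") (auto simp: W_def X_def)
  \<comment> \<open>The cutoff likewise removes the difference between \<open>q\<close> and its
    truncation \<open>p\<close>.\<close>
  have Xp: "X x * (p x * U x) = X x * (q x * U x)" for x
    using h0[of x] by (cases "x \<in> {a..a+d}") (auto simp: p_def X_def)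
  have X1W: "X1 x * W x = X1 x * V x" for x
    using h0[of x] by (cases "x \<in> {a..a+d}") (auto simp: W_def X1_def)
  have y_AC: "AC_loc y"
    unfolding y_def[abs_def] by (intro AC_loc_mult U_AC AC_loc_C1[OF X_deriv] X_cont U(1))
  have y1_AC: "AC_loc y1"
    unfolding y1_def[abs_def]
    by (intro AC_loc_add AC_loc_mult U_AC V_AC AC_loc_C1[OF X_deriv] AC_loc_C1[OF X1_deriv] X_cont U(1) V_cont)
  have "ae_deriv y (\<lambda>x. X x * W x + X1 x * U x)"
    unfolding y_def[abs_def] by (intro ae_deriv_mult ae_deriv_everywhere X_deriv U_deriv)
  also have "(\<lambda>x. X x * W x + X1 x * U x) = y1"
    by (rule ext) (simp add: y1_def XW)
  finally have y_deriv: "ae_deriv y y1" .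
  have "ae_deriv y1 (\<lambda>x. (X1 x * W x + X2 x * U x) + (X x * (p x * U x) + X1 x * V x))"
    unfolding y1_def[abs_def]
    by (intro ae_deriv_add ae_deriv_mult ae_deriv_everywhere X_deriv X1_deriv U_deriv V_deriv)
  also have "(\<lambda>x. (X1 x * W x + X2 x * U x) + (X x * (p x * U x) + X1 x * V x)) = y2"
    by (rule ext, simp only: y2_def Xp X1W) (simp add: algebra_simps)
  finally have y1_deriv: "ae_deriv y1 y2" .
  have y0: "y x = 0" "y1 x = 0" "g x = 0" if "x \<notin> {a<..<a+d}" for x
    using h0[OF that] by (simp_all add: y_def y1_def g_def X_def X1_def X2_def)
  have y_cont: "continuous_on UNIV y" and g_cont: "continuous_on UNIV g"
    unfolding y_def[abs_def] g_def[abs_def] by (intro continuous_intros X_cont U(1) V_cont)+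
  have y_bd: "cmod (y x) \<le> 2" for x
    using mult_mono[OF X_bd U_ub, of x x] by (simp add: y_def norm_mult)
  have g_bd: "cmod (g x) \<le> 24 + 12 * C" for x
  proof -
    have "cmod (g x) \<le> cmod (X2 x) * cmod (U x) + 2 * (cmod (X1 x) * cmod (V x))"
      unfolding g_def norm_minus_cancel
      using norm_triangle_ineq[of "X2 x * U x" "2 * X1 x * V x"] by (simp add: norm_mult)
    \<comment> \<open>The value is 16 + 12 C, rounded up in the final bound.\<close>
    also have "\<dots> \<le> 12 * (4/3) + 2 * (3 * (2 * C))"
      by (intro add_mono mult_left_mono mult_mono X2_bd U_ub X1_bd V_bd) auto
    finally show ?thesis by simp
  qed
  have y_lb: "2/3 * (d\<^sup>2/16)^3 \<le> cmod (y x)" if x: "x \<in> {a+d/4..a+3*d/4}" for x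
  proof -
    \<comment> \<open>On the middle half of the interval both distances to the endpoints are at
      least d/4.\<close>
    have "(d/4) * (d/4) \<le> (x - a) * (a + d - x)" using x d by (intro mult_mono) auto
    then have "d\<^sup>2/16 \<le> h x" by (simp add: h_def hump_def power2_eq_square)
    then have "(d\<^sup>2/16)^3 \<le> h x ^ 3" by (intro power_mono) auto
    then have "(d\<^sup>2/16)^3 * (2/3) \<le> cmod (X x) * cmod (U x)"
      using U_lb[of x] h(1)[of x] by (intro mult_mono) (auto simp: X_def norm_power)
    then show ?thesis by (simp add: y_def norm_mult)
  qed
  have "y \<in> L2p" by (rule cont_bounded_support_L2p[OF y_cont y_bd, of a "a+d"]) (use y0 in auto)
  moreover have "g \<in> L2p" by (rule cont_bounded_support_L2p[OF g_cont g_bd, of a "a+d"]) (use y0 in auto)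
  moreover have "g = (\<lambda>x. - y2 x + q x * y x)"
    by (rule ext) (simp add: g_def y2_def y_def algebra_simps)
  \<comment> \<open>As a >= 0, the point 0 lies outside the open interval even when a = 0; hence
    both boundary conditions hold.\<close>
  moreover have "y 0 = 0" "y1 0 = 0" using y0[of 0] a by auto
  moreover have "\<exists>x0>0. \<forall>x\<ge>x0. y x = 0" using y0(1) a d by (intro exI[of _ "a+d"]) auto
  ultimately have "(y, g) \<in> L0graph q"
    unfolding L0graph_def using y_AC y1_AC y_deriv y1_deriv by blast
  then show ?thesis
    by (intro exI[of _ y] exI[of _ g] conjI allI ballI impI y_cont g_cont y0 y_bd g_bd y_lb)
qed

section \<open>Necessity of the Molchanov condition\<close>

text \<open>A sequence of left endpoints and a common length describe the system; half-open
  intervals may touch without overlapping, and endpoints do not affect the integrals.\<close>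

theorem theorem1:
  fixes q :: "real \<Rightarrow> complex"
  assumes "L1loc q"
    and "\<exists>G. is_operator G \<and> extends G (L0graph q) \<and> has_compact_resolvent G"
  shows "\<forall>(a::nat \<Rightarrow> real) (h::real).
           h > 0 \<and> (\<forall>n. a n \<ge> 0) \<and>
           (\<forall>m n. m \<noteq> n \<longrightarrow> {a m..<a m + h} \<inter> {a n..<a n + h} = {}) \<longrightarrow>
           filterlim (\<lambda>n. LINT x:{a n..<a n + h}|lborel. cmod (q x)) at_top sequentially"
proof (intro allI impI, rule ccontr)
  fix a :: "nat \<Rightarrow> real" and h :: real
  assume "h > 0 \<and> (\<forall>n. a n \<ge> 0) \<and> (\<forall>m n. m \<noteq> n \<longrightarrow> {a m..<a m + h} \<inter> {a n..<a n + h} = {})"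
  then have h: "h > 0" and a: "\<And>n. 0 \<le> a n"
    and disj: "\<And>m n. m \<noteq> n \<Longrightarrow> {a m..<a m + h} \<inter> {a n..<a n + h} = {}" by auto
  let ?I = "\<lambda>n. LINT x:{a n..<a n + h}|lborel. cmod (q x)"
  assume "\<not> filterlim ?I at_top sequentially"
  then obtain Z where "\<not> (\<forall>\<^sub>F n in sequentially. Z \<le> ?I n)"
    unfolding filterlim_at_top by blast
  then have "\<forall>N. \<exists>n\<ge>N. ?I n < Z"
    unfolding eventually_sequentially by (simp add: not_le)
  then have "infinite {n. ?I n < Z}"
    unfolding infinite_nat_iff_unbounded_le by simp
  then obtain r :: "nat \<Rightarrow> nat" where r: "strict_mono r" "\<And>n. ?I (r n) < Z"
    using infinite_enumerate by blast
  \<comment> \<open>C >= 1 gives 1/(4C) <= 1, hence d <= 1. The bound 1/(4C) on \<open>d\<close>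
    yields the contraction condition, and h/2 makes d < h, so that the closed short intervals fit
    into the half-open ones.\<close>
  define C where "C = max Z 1"
  define d where "d = min (h/2) (1/(4*C))"
  have C: "1 \<le> C" "Z \<le> C" by (simp_all add: C_def)
  have dC: "d \<le> 1/(4*C)" "1/(4*C) \<le> 1" using C by (simp_all add: d_def)
  have "0 < d" using h C by (simp add: d_def)
  moreover have "d < h" using h min.cobounded1[of "h/2" "1/(4*C)"] unfolding d_def by linarith
  ultimately have d: "0 < d" "d < h" "d \<le> 1" using dC by linarith+
  have Cd: "C * d \<le> 1/4" using dC(1) C by (simp add: field_simps)
  define \<alpha> where "\<alpha> n = a (r n)" for n
  have \<alpha>: "0 \<le> \<alpha> n" for n by (simp add: \<alpha>_def a)
  have \<alpha>_disj: "{\<alpha> m..<\<alpha> m + h} \<inter> {\<alpha> n..<\<alpha> n + h} = {}" if "m \<noteq> n" for m n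
    unfolding \<alpha>_def using disj[of "r m" "r n"] strict_mono_eq[OF r(1)] that by blast
  have small: "(LINT x:{\<alpha> n..\<alpha> n + d}|lborel. cmod (q x)) \<le> C" for n
  proof -
    have "set_integrable lborel {0..\<alpha> n + h} q" using assms(1) \<alpha>[of n] h by (simp add: L1loc_def)
    then have i: "set_integrable lborel S (\<lambda>x. cmod (q x))" if "S \<in> sets borel" "S \<subseteq> {0..\<alpha> n + h}" for S
      by (intro set_integrable_norm) (rule set_integrable_subset, use that in auto)
    have "(LINT x:{\<alpha> n..\<alpha> n + d}|lborel. cmod (q x)) \<le> ?I (r n)"
      unfolding set_lebesgue_integral_def \<alpha>_def[symmetric]
    proof (rule integral_mono)
      show "integrable lborel (\<lambda>x. indicator {\<alpha> n..\<alpha> n + d} x *\<^sub>R cmod (q x))"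
        "integrable lborel (\<lambda>x. indicator {\<alpha> n..<\<alpha> n + h} x *\<^sub>R cmod (q x))"
        by (rule i[unfolded set_integrable_def]; use \<alpha>[of n] d in \<open>fastforce simp: subset_iff\<close>)+
    qed (use d in \<open>auto simp: indicator_def\<close>)
    with r(2)[of n] C show ?thesis by linarith
  qed
  have "\<forall>n. \<exists>y g. (y, g) \<in> L0graph q \<and> continuous_on UNIV y \<and> continuous_on UNIV g \<and>
    (\<forall>x. x \<notin> {\<alpha> n<..<\<alpha> n + d} \<longrightarrow> y x = 0 \<and> g x = 0) \<and>
    (\<forall>x. cmod (y x) \<le> 2 \<and> cmod (g x) \<le> 24 + 12 * C) \<and>
    (\<forall>x\<in>{\<alpha> n + d/4..\<alpha> n + 3*d/4}. 2/3 * (d\<^sup>2/16)^3 \<le> cmod (y x))"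
    by (intro allI localized_test_function assms(1) \<alpha> d Cd small) (use C in simp)
  then obtain y g where yg: "\<And>n. (y n, g n) \<in> L0graph q"
    and cont: "\<And>n. continuous_on UNIV (y n)" "\<And>n. continuous_on UNIV (g n)"
    and supp: "\<And>n x. x \<notin> {\<alpha> n<..<\<alpha> n + d} \<Longrightarrow> y n x = 0 \<and> g n x = 0"
    and ub: "\<And>n x. cmod (y n x) \<le> 2" "\<And>n x. cmod (g n x) \<le> 24 + 12 * C"
    and lb: "\<And>n x. x \<in> {\<alpha> n + d/4..\<alpha> n + 3*d/4} \<Longrightarrow> 2/3 * (d\<^sup>2/16)^3 \<le> cmod (y n x)"
    unfolding choice_iff by blast
  from assms(2) obtain G \<mu> where G: "is_operator G" "extends G (L0graph q)"
    and compact: "\<And>(s::nat \<Rightarrow> (real \<Rightarrow> complex) \<times> (real \<Rightarrow> complex)) B.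
        (\<forall>n. s n \<in> G \<and> l2norm (\<lambda>x. snd (s n) x - \<mu> * fst (s n) x) \<le> B) \<Longrightarrow>
        \<exists>r::nat\<Rightarrow>nat. strict_mono r \<and> (\<forall>\<epsilon>>0. \<exists>N. \<forall>m\<ge>N. \<forall>n\<ge>N.
            l2norm (\<lambda>x. fst (s (r m)) x - fst (s (r n)) x) < \<epsilon>)"
    unfolding has_compact_resolvent_def by blast
  \<comment> \<open>The extension contains each test pair only up to equality almost everywhere;
    compactness is applied to the representatives.\<close>
  have "\<exists>z k. (z, k) \<in> G \<and> z \<doteq> y n \<and> k \<doteq> g n" for n
    using G(2) yg[of n] unfolding extends_def by blast
  then obtain z k where zk: "\<And>n. (z n, k n) \<in> G" "\<And>n. z n \<doteq> y n" "\<And>n. k n \<doteq> g n" by metis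
  have meas: "set_borel_measurable lborel {0..} (z n)" "set_borel_measurable lborel {0..} (k n)"
    "set_borel_measurable lborel {0..} (y n)" "set_borel_measurable lborel {0..} (g n)" for n
    using zk(1)[of n] G(1) yg[of n] unfolding is_operator_def L0graph_def L2p_def by auto
  \<comment> \<open>The sup bound of \<open>g n - \<mu> * y n\<close> times the square root of the
    length of its support, independent of \<open>n\<close>.\<close>
  define B where "B = (24 + 12 * C + cmod \<mu> * 2) * sqrt d"
  have "l2norm (\<lambda>x. k n x - \<mu> * z n x) \<le> B" for n
  proof -
    have "l2norm (\<lambda>x. k n x - \<mu> * z n x) = l2norm (\<lambda>x. g n x - \<mu> * y n x)"
      using zk(2,3)[of n] unfolding ae_eq_def
      by (intro l2norm_cong_AE set_borel_measurable_diff_scaled meas) (auto simp: ae_eq_def)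
    also have "\<dots> \<le> (24 + 12 * C + cmod \<mu> * 2) * sqrt (\<alpha> n + d - \<alpha> n)"
    proof (rule cont_bounded_support_L2p(2))
      show "cmod (g n x - \<mu> * y n x) \<le> 24 + 12 * C + cmod \<mu> * 2" for x
        using norm_triangle_ineq4[of "g n x" "\<mu> * y n x"] ub(2)[of n x]
          mult_left_mono[OF ub(1)[of n x], of "cmod \<mu>"] by (simp add: norm_mult)
      show "continuous_on UNIV (\<lambda>x. g n x - \<mu> * y n x)"
        by (intro continuous_intros cont)
    qed (use supp d in auto)
    finally show ?thesis by (simp add: B_def)
  qed
  then obtain \<rho> :: "nat \<Rightarrow> nat" where \<rho>: "strict_mono \<rho>"
    "\<forall>\<epsilon>>0. \<exists>N. \<forall>m\<ge>N. \<forall>n\<ge>N. l2norm (\<lambda>x. z (\<rho> m) x - z (\<rho> n) x) < \<epsilon>"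
    using compact[of "\<lambda>n. (z n, k n)" B] zk(1) by auto
  \<comment> \<open>The pointwise lower bound times the square root of the length d/2 of the middle
    half: any two distinct test functions are at least this far apart, so no subsequence is
    Cauchy.\<close>
  define \<kappa> where "\<kappa> = 2/3 * (d\<^sup>2/16)^3 * sqrt (d/2)"
  have "\<kappa> > 0" using d by (simp add: \<kappa>_def)
  then obtain N where N: "\<And>m n. m \<ge> N \<Longrightarrow> n \<ge> N \<Longrightarrow> l2norm (\<lambda>x. z (\<rho> m) x - z (\<rho> n) x) < \<kappa>"
    using \<rho>(2) by blast
  define m n where "m = \<rho> N" and "n = \<rho> (Suc N)"
  have mn: "m \<noteq> n" unfolding m_def n_def using strict_mono_eq[OF \<rho>(1)] by simp
  have "\<kappa> \<le> l2norm (\<lambda>x. y m x - y n x)"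
  proof -
    have "2/3 * (d\<^sup>2/16)^3 * sqrt (\<alpha> m + 3*d/4 - (\<alpha> m + d/4)) \<le> l2norm (\<lambda>x. y m x - y n x)"
    proof (rule l2norm_lower_bound)
      show "(\<lambda>x. y m x - y n x) \<in> L2p"
      proof (rule cont_bounded_support_L2p(1))
        show "continuous_on UNIV (\<lambda>x. y m x - y n x)"
          by (intro continuous_intros cont)
        show "cmod (y m x - y n x) \<le> 4" for x
          using norm_triangle_ineq4[of "y m x" "y n x"] ub(1)[of m x] ub(1)[of n x] by linarith
        \<comment> \<open>As both left endpoints are nonnegative, this one interval covers both
          supports.\<close>
        show "y m x - y n x = 0" if "x \<notin> {0..\<alpha> m + \<alpha> n + d}" for x
        proof -
          have "x \<notin> {\<alpha> m<..<\<alpha> m + d}" "x \<notin> {\<alpha> n<..<\<alpha> n + d}"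
            using that \<alpha>[of m] \<alpha>[of n] by auto
          then show ?thesis using supp by simp
        qed
      qed
      show "2/3 * (d\<^sup>2/16)^3 \<le> cmod (y m x - y n x)" if x: "x \<in> {\<alpha> m + d/4..\<alpha> m + 3*d/4}" for x
      proof -
        have "x \<in> {\<alpha> m..<\<alpha> m + h}" using x d by auto
        \<comment> \<open>By disjointness \<open>y n\<close> vanishes on the middle half of the
          other interval, so the lower bound for \<open>y m\<close> survives in the
          difference.\<close>
        then have "x \<notin> {\<alpha> n<..<\<alpha> n + d}" using \<alpha>_disj[OF mn] d by auto
        then show ?thesis using supp lb[OF x] by simp
      qed
    qed (use \<alpha>[of m] d in auto)
    then show ?thesis by (simp add: \<kappa>_def)
  qed
  also have "l2norm (\<lambda>x. y m x - y n x) = l2norm (\<lambda>x. z m x - z n x)"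
  proof (rule l2norm_cong_AE)
    show "set_borel_measurable lborel {0..} (\<lambda>x. y m x - y n x)"
      "set_borel_measurable lborel {0..} (\<lambda>x. z m x - z n x)"
      using set_borel_measurable_diff_scaled[OF meas(3)[of m] meas(3)[of n], of 1]
        set_borel_measurable_diff_scaled[OF meas(1)[of m] meas(1)[of n], of 1] by simp_all
    show "(\<lambda>x. y m x - y n x) \<doteq> (\<lambda>x. z m x - z n x)"
      using zk(2)[of m] zk(2)[of n] unfolding ae_eq_def by eventually_elim auto
  qed
  also have "\<dots> < \<kappa>" unfolding m_def n_def by (rule N) auto
  finally show False by simp
qed

end
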